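(* Let $\mathcal{T}_p$ be the perfectoid Tate curve over a perfectoid field $K$ with parameter $q$, $0<|q|<1$. Then its (Čech) cohomology with coefficients in the structure sheaf satisfies $$H^i(\mathcal{O}_{\mathcal{T}_p},\mathcal{T}_p)\cong\begin{cases}K & i=0,1,\\ 0 & i\ge 2.\end{cases}$$
   Context: $p$ is the residue characteristic of $K$, and compatible roots $q^{1/p^j}$ are fixed. For radii $|r_1|\le|r_2|$ the annulus $\mathbb{B}(r_1,r_2)=\{|r_1|\le|X|\le|r_2|\}$ is given the ring $K\langle X/r_2,r_1/X\rangle_\infty=\bigcup_{j\ge0}K\langle (X/r_2)^{1/p^j},(r_1/X)^{1/p^j}\rangle$, i.e. series $\sum_{n\in\mathbb{Z}[1/p]}$ in the corresponding variables with coefficients tending to $0$. The perfectoid Tate curve $\mathcal{T}_p=\mathbb{G}_{m,K}/q^{\mathbb{Z}}$ is covered by $U_0=\mathbb{B}(q,q^{-1})$ (ring $K\langle qX,q/X\rangle_\infty$) and $U_1=\mathbb{B}(q^2,q)$ (ring $K\langle X/q,q^2/X\rangle_\infty$), with $U_0\cap U_1=U_{0,1,+}\sqcup U_{0,1,-}$ where $U_{0,1,+}=\mathbb{B}(q,q)$ (ring $K\langle X/q,q/X\rangle_\infty$) and $U_{0,1,-}=\mathbb{B}(q^2,q^2)$ (ring $K\langle X/q^2,q^2/X\rangle_\infty$), the latter being identified with the outer boundary $U_{0+}=\mathbb{B}(q^{-1},q^{-1})$ of $U_0$ via multiplication by $q^{-3}$ (ring map $X\mapsto X/q^3$). The cohomology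 is that of the Čech complex $\mathcal{O}(U_0)\oplus\mathcal{O}(U_1)\to\mathcal{O}(U_{0,1,+})\oplus\mathcal{O}(U_{0,1,-})\to0$ given by the difference of restriction maps. *)

theory Defs
  imports "HOL-Algebra.Algebraic_Closure_Type" "HOL-Algebra.Chinese_Remainder"
begin

section \<open>Perfectoid fields\<close>

text \<open>
  A perfectoid field of residue characteristic \<open>p\<close>: a field complete with respect to a
  nonarchimedean absolute value \<open>v\<close> whose value group is not discrete, such that \<open>p\<close> lies in the
  maximal ideal and Frobenius is surjective on \<open>O/pO\<close>, with \<open>O\<close> the ring of integers. The
  characteristic of the field may be \<open>0\<close> or \<open>p\<close>.
\<close>

locale perfectoid_field =
  fixes v :: "'k::field \<Rightarrow> real" and p :: nat
  assumes nonneg: "0 \<le> v x"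
    and eq_0_iff: "v x = 0 \<longleftrightarrow> x = 0"
    and mult: "v (x * y) = v x * v y"
    and ultrametric: "v (x + y) \<le> max (v x) (v y)"
    and complete:
      "(\<forall>e>0. \<exists>N. \<forall>m\<ge>N. \<forall>n\<ge>N. v (s m - s n) < e) \<Longrightarrow>
        \<exists>l. (\<lambda>n::nat. v (s n - l)) \<longlonglongrightarrow> 0"
    and nondiscrete: "\<not> (\<exists>g>0. v ` (UNIV - {0}) \<subseteq> range (\<lambda>n::int. g powi n))"
    and prime_p: "Factorial_Ring.prime p"
    and residue_char: "v (of_nat p) < 1"
    and frobenius_surj:
      "v x \<le> 1 \<Longrightarrow> \<exists>y z. v y \<le> 1 \<and> v z \<le> 1 \<and> x = y ^ p + of_nat p * z"


section \<open>Rings of functions on annuli\<close>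

definition p_inv_ints :: "nat \<Rightarrow> nat \<Rightarrow> rat set"
  where "p_inv_ints p j = {of_int m / of_nat p ^ j | m. True}"

text \<open>
  For a compatible system \<open>r j = q\<^bsup>1/p^j\<^esup>\<close>, this is \<open>q\<^sup>x\<close> for \<open>x \<in> \<int>[1/p]\<close> (and irrelevant for
  other \<open>x\<close>).
\<close>

definition root_pow :: "nat \<Rightarrow> (nat \<Rightarrow> 'k::field) \<Rightarrow> rat \<Rightarrow> 'k"
  where "root_pow p r x =
    (let j = (LEAST j. x \<in> p_inv_ints p j) in r j powi \<lfloor>x * of_nat p ^ j\<rfloor>)"

text \<open>
  A family \<open>c\<close> stands for the series \<open>\<Sum>n. c n X\<^sup>n\<close>. In terms of the variables \<open>X/r\<^sub>2\<close> and \<open>r\<^sub>1/X\<close>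
  with \<open>r\<^sub>1 = q\<^sup>a\<close>, \<open>r\<^sub>2 = q\<^sup>b\<close>, the \<open>n\<close>-th term is \<open>c n q\<^bsup>bn\<^esup> (X/r\<^sub>2)\<^sup>n\<close> if \<open>n \<ge> 0\<close> and
  \<open>c n q\<^bsup>an\<^esup> (r\<^sub>1/X)\<^bsup>-n\<^esup>\<close> if \<open>n < 0\<close>; these coefficients have to tend to \<open>0\<close>.
\<close>

definition annulus_series ::
    "('k::field \<Rightarrow> real) \<Rightarrow> nat \<Rightarrow> (nat \<Rightarrow> 'k) \<Rightarrow> rat set \<Rightarrow> int \<Rightarrow> int \<Rightarrow> (rat \<Rightarrow> 'k) set"
  where "annulus_series v p r E a b =
    {c. (\<forall>n. n \<notin> E \<longrightarrow> c n = 0) \<and>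
        ((\<lambda>n. v (c n * root_pow p r (of_int (if 0 \<le> n then b else a) * n))) \<longlongrightarrow> 0) cofinite}"

definition series_mult ::
    "('k::field \<Rightarrow> real) \<Rightarrow> (rat \<Rightarrow> 'k) \<Rightarrow> (rat \<Rightarrow> 'k) \<Rightarrow> rat \<Rightarrow> 'k"
  where "series_mult v c c' n =
    (THE s. ((\<lambda>F. v ((\<Sum>m\<in>F. c m * c' (n - m)) - s)) \<longlongrightarrow> 0) (finite_subsets_at_top UNIV))"

definition series_algebra ::
    "('k::field \<Rightarrow> real) \<Rightarrow> (rat \<Rightarrow> 'k) set \<Rightarrow> ('k, rat \<Rightarrow> 'k) module"
  where "series_algebra v S =
    \<lparr>carrier = S, monoid.mult = series_mult v, one = (\<lambda>n. if n = 0 then 1 else 0),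
     ring.zero = (\<lambda>n. 0), add = (\<lambda>c c' n. c n + c' n), module.smult = (\<lambda>k c n. k * c n)\<rparr>"

text \<open>
  The ring of the annulus \<open>|q\<^sup>a| \<le> |X| \<le> |q\<^sup>b|\<close>: first the union of the rings
  \<open>K\<langle>(X/q\<^sup>b)\<^bsup>1/p^j\<^esup>, (q\<^sup>a/X)\<^bsup>1/p^j\<^esup>\<rangle>\<close> over all \<open>j\<close>, where each series has exponents of bounded
  denominator, then its completion, consisting of all series with exponents in \<open>\<int>[1/p]\<close> whose
  coefficients tend to \<open>0\<close>.
\<close>

definition annulus_union ::
    "('k::field \<Rightarrow> real) \<Rightarrow> nat \<Rightarrow> (nat \<Rightarrow> 'k) \<Rightarrow> int \<Rightarrow> int \<Rightarrow> ('k, rat \<Rightarrow> 'k) module"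
  where "annulus_union v p r a b =
    series_algebra v (\<Union>j. annulus_series v p r (p_inv_ints p j) a b)"

definition annulus_completed ::
    "('k::field \<Rightarrow> real) \<Rightarrow> nat \<Rightarrow> (nat \<Rightarrow> 'k) \<Rightarrow> int \<Rightarrow> int \<Rightarrow> ('k, rat \<Rightarrow> 'k) module"
  where "annulus_completed v p r a b =
    series_algebra v (annulus_series v p r (\<Union>j. p_inv_ints p j) a b)"


section \<open>Cohomology of complexes of modules\<close>

text \<open>
  The multiplicative fields of a \<open>module\<close> record play no role in the \<open>module\<close> locale; those of
  the quotients below carry no meaning.
\<close>

definition module_dirsum ::
    "('r, 'a) module \<Rightarrow> ('r, 'b) module \<Rightarrow> ('r, 'a \<times> 'b) module"
  where "module_dirsum M N =
    ring.extend (RDirProd M N) (module.fields (\<lambda>k (x, y). (k \<odot>\<^bsub>M\<^esub> x, k \<odot>\<^bsub>N\<^esub> y)))"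

definition quotient_module :: "('r, 'a) module \<Rightarrow> 'a set \<Rightarrow> ('r, 'a set) module"
  where "quotient_module M B =
    ring.extend (M Quot B) (module.fields (\<lambda>k A. \<Union>x\<in>A. B +>\<^bsub>M\<^esub> (k \<odot>\<^bsub>M\<^esub> x)))"

definition module_iso ::
    "('r, 'm) ring_scheme \<Rightarrow> ('r, 'a) module \<Rightarrow> ('r, 'b) module \<Rightarrow> ('a \<Rightarrow> 'b) set"
  where "module_iso R M N =
    {h \<in> iso (add_monoid M) (add_monoid N).
      \<forall>k\<in>carrier R. \<forall>x\<in>carrier M. h (k \<odot>\<^bsub>M\<^esub> x) = k \<odot>\<^bsub>N\<^esub> h x}"

definition regular_module :: "'r ring \<Rightarrow> ('r, 'r) module"
  where "regular_module R = ring.extend R (module.fields (monoid.mult R))"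

definition cocycles ::
    "(nat \<Rightarrow> ('r, 'a) module) \<Rightarrow> (nat \<Rightarrow> 'a \<Rightarrow> 'a) \<Rightarrow> nat \<Rightarrow> 'a set"
  where "cocycles C d i = a_kernel (C i) (C (Suc i)) (d i)"

definition coboundaries ::
    "(nat \<Rightarrow> ('r, 'a) module) \<Rightarrow> (nat \<Rightarrow> 'a \<Rightarrow> 'a) \<Rightarrow> nat \<Rightarrow> 'a set"
  where "coboundaries C d i =
    (case i of 0 \<Rightarrow> {\<zero>\<^bsub>C 0\<^esub>} | Suc j \<Rightarrow> d j ` carrier (C j))"

definition cohomology ::
    "(nat \<Rightarrow> ('r, 'a) module) \<Rightarrow> (nat \<Rightarrow> 'a \<Rightarrow> 'a) \<Rightarrow> nat \<Rightarrow> ('r, 'a set) module"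
  where "cohomology C d i =
    quotient_module ((C i)\<lparr>carrier := cocycles C d i\<rparr>) (coboundaries C d i)"


section \<open>Cech complex of the perfectoid Tate curve\<close>

text \<open>
  Here \<open>A a b\<close> is the ring of the annulus \<open>|q\<^sup>a| \<le> |X| \<le> |q\<^sup>b|\<close>. The opens \<open>U\<^sub>0\<close>, \<open>U\<^sub>1\<close>,
  \<open>U\<^sub>0\<^sub>,\<^sub>1\<^sub>,\<^sub>+\<close>, \<open>U\<^sub>0\<^sub>,\<^sub>1\<^sub>,\<^sub>-\<close> correspond to \<open>(a, b) = (1, -1), (2, 1), (1, 1), (2, 2)\<close>.
\<close>

definition tate_cochains ::
    "(int \<Rightarrow> int \<Rightarrow> ('k, rat \<Rightarrow> 'k) module) \<Rightarrow> nat \<Rightarrow>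
      ('k, (rat \<Rightarrow> 'k) \<times> (rat \<Rightarrow> 'k)) module"
  where "tate_cochains A i =
    (if i = 0 then module_dirsum (A 1 (-1)) (A 2 1)
     else if i = 1 then module_dirsum (A 1 1) (A 2 2)
     else (module_dirsum (A 1 1) (A 2 2))\<lparr>carrier := {\<zero>\<^bsub>module_dirsum (A 1 1) (A 2 2)\<^esub>}\<rparr>)"

text \<open>
  \<open>X \<mapsto> X/q\<^sup>3\<close>, from the outer boundary \<open>|X| = |q\<^bsup>-1\<^esup>|\<close> of \<open>U\<^sub>0\<close> to \<open>|X| = |q\<^sup>2|\<close>.
\<close>

definition tate_glue :: "nat \<Rightarrow> (nat \<Rightarrow> 'k::field) \<Rightarrow> (rat \<Rightarrow> 'k) \<Rightarrow> rat \<Rightarrow> 'k"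
  where "tate_glue p r c = (\<lambda>n. c n * root_pow p r (- 3 * n))"

text \<open>
  All other restriction maps are restrictions of functions to smaller annuli, which do not change
  the series.
\<close>

definition tate_diff ::
    "nat \<Rightarrow> (nat \<Rightarrow> 'k::field) \<Rightarrow> nat \<Rightarrow> (rat \<Rightarrow> 'k) \<times> (rat \<Rightarrow> 'k) \<Rightarrow> (rat \<Rightarrow> 'k) \<times> (rat \<Rightarrow> 'k)"
  where "tate_diff p r i =
    (\<lambda>(f, g). if i = 0 then (\<lambda>n. f n - g n, \<lambda>n. tate_glue p r f n - g n)
              else (\<lambda>n. 0, \<lambda>n. 0))"

definition tate_cohomology ::
    "nat \<Rightarrow> (nat \<Rightarrow> 'k::field) \<Rightarrow> (int \<Rightarrow> int \<Rightarrow> ('k, rat \<Rightarrow> 'k) module) \<Rightarrow> nat \<Rightarrow>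
      ('k, ((rat \<Rightarrow> 'k) \<times> (rat \<Rightarrow> 'k)) set) module"
  where "tate_cohomology p r A i = cohomology (tate_cochains A) (tate_diff p r) i"

end

theory Submission
  imports Defs
begin

text \<open>
  A series converges on an annulus iff its terms tend to \<open>0\<close> on both boundary circles, so the
  restrictions and the glueing are easily described in terms of circles: \<open>X \<mapsto> X/q\<^sup>3\<close> carries
  series on \<open>|X| = |q|\<^sup>s\<close> to series on \<open>|X| = |q|\<^bsup>s+3\<^esup>\<close>. On the coefficients of \<open>X\<^sup>n\<close> the differential
  is \<open>(f, g) \<mapsto> (f - g, q\<^bsup>-3n\<^esup> f - g)\<close>, with determinant \<open>q\<^bsup>-3n\<^esup> - 1\<close>. For \<open>n \<noteq> 0\<close> the ultrametric
  inequality gives \<open>|1 - q\<^bsup>-3n\<^esup>| = max 1 |q|\<^bsup>-3n\<^esup>\<close> exactly, however small \<open>n\<close> is. Hence dividing by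
  \<open>1 - q\<^bsup>-3n\<^esup>\<close> turns convergence on \<open>|X| = |q|\<^sup>s\<close> into convergence for \<open>|q|\<^sup>s \<le> |X| \<le> |q|\<^bsup>s-3\<^esup>\<close>, and
  this suffices to solve the system. Only \<open>n = 0\<close> contributes to the cohomology, one copy of \<open>K\<close> in
  each of the degrees \<open>0\<close> and \<open>1\<close>.
\<close>

section \<open>Modules and their cohomology\<close>

locale module_morphism =
  M?: module R M + N?: module R N + abelian_group_hom M N h
  for R :: "('r, 'm) ring_scheme" and M :: "('r, 'a) module" and N :: "('r, 'b) module" and h +
  assumes hom_smult: "k \<in> carrier R \<Longrightarrow> x \<in> carrier M \<Longrightarrow> h (k \<odot>\<^bsub>M\<^esub> x) = k \<odot>\<^bsub>N\<^esub> h x"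

lemma module_morphismI:
  assumes M: "module R M" and N: "module R N"
    and closed: "\<And>x. x \<in> carrier M \<Longrightarrow> h x \<in> carrier N"
    and add: "\<And>x y. x \<in> carrier M \<Longrightarrow> y \<in> carrier M \<Longrightarrow> h (x \<oplus>\<^bsub>M\<^esub> y) = h x \<oplus>\<^bsub>N\<^esub> h y"
    and smult: "\<And>k x. k \<in> carrier R \<Longrightarrow> x \<in> carrier M \<Longrightarrow> h (k \<odot>\<^bsub>M\<^esub> x) = k \<odot>\<^bsub>N\<^esub> h x"
  shows "module_morphism R M N h"
proof -
  interpret M: module R M by (fact M)
  interpret N: module R N by (fact N)
  have "h \<in> hom (add_monoid M) (add_monoid N)"
    by (rule homI) (simp_all only: monoid.simps partial_object.simps closed add)
  then show ?thesis
    by unfold_locales (simp_all only: smult)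
qed

context module_morphism
begin

lemma mem_a_kernel_iff: "x \<in> a_kernel M N h \<longleftrightarrow> x \<in> carrier M \<and> h x = \<zero>\<^bsub>N\<^esub>"
  unfolding a_kernel_def' by (rule mem_Collect_eq)

lemma a_kernel_submodule: "submodule (a_kernel M N h) R M"
proof (intro submodule.intro submodule_axioms.intro)
  show "subgroup (a_kernel M N h) (add_monoid M)"
    using additive_subgroup_a_kernel by (rule additive_subgroup.a_subgroup)
  show "k \<odot>\<^bsub>M\<^esub> x \<in> a_kernel M N h" if "k \<in> carrier R" "x \<in> a_kernel M N h" for k x
    using that by (simp add: mem_a_kernel_iff hom_smult)
qed

lemma restrict_submodule:
  assumes "submodule H R M"
  shows "module_morphism R (M\<lparr>carrier := H\<rparr>) N h"
proof (rule module_morphismI)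
  show "module R (M\<lparr>carrier := H\<rparr>)"
    using assms M.module_axioms by (rule submodule.submodule_is_module)
qed (use M.submoduleE(1)[OF assms] in \<open>simp_all add: N.module_axioms hom_smult subset_iff\<close>)

lemma a_kernel_coset:
  assumes "x \<in> carrier M"
  shows "a_kernel M N h +>\<^bsub>M\<^esub> x = {y \<in> carrier M. h y = h x}"
proof -
  interpret ker: abelian_subgroup "a_kernel M N h" M
    by (rule abelian_subgroup_a_kernel)
  have "y \<in> a_kernel M N h +>\<^bsub>M\<^esub> x \<longleftrightarrow> h y = h x" if y: "y \<in> carrier M" for y
    using assms y
    by (simp add: ker.a_rcos_module mem_a_kernel_iff N.M.add.inv_solve_right'[folded a_inv_def])
  then show ?thesis
    using ker.a_elemrcos_carrier[OF assms] by blast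
qed

theorem first_isomorphism:
  assumes "h ` carrier M = carrier N"
  shows "(\<lambda>A. the_elem (h ` A)) \<in> module_iso R (quotient_module M (a_kernel M N h)) N"
proof -
  let ?Q = "quotient_module M (a_kernel M N h)"
  have the_elem_coset: "the_elem (h ` (a_kernel M N h +>\<^bsub>M\<^esub> x)) = h x" if "x \<in> carrier M" for x
    using that by (intro the_elem_image_unique) (auto simp: a_kernel_coset)
  have "carrier ?Q = carrier (M A_Mod a_kernel M N h)" "add ?Q = monoid.mult (M A_Mod a_kernel M N h)"
    by (simp_all add: quotient_module_def ring.defs module.defs FactRing_def A_FactGroup_def')
  then have "(\<lambda>A. the_elem (h ` A)) \<in> iso (add_monoid ?Q) (add_monoid N)"
    using A_FactGroup_iso_set[OF assms] by (simp add: iso_def hom_def)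
  moreover have "the_elem (h ` (k \<odot>\<^bsub>?Q\<^esub> A)) = k \<odot>\<^bsub>N\<^esub> the_elem (h ` A)"
    if k: "k \<in> carrier R" and A: "A \<in> carrier ?Q" for k A
  proof -
    obtain x where x: "x \<in> carrier M" "A = a_kernel M N h +>\<^bsub>M\<^esub> x"
      using A by (auto simp: quotient_module_def ring.defs module.defs FactRing_def A_RCOSETS_def')
    have "k \<odot>\<^bsub>?Q\<^esub> A = (\<Union>y\<in>A. a_kernel M N h +>\<^bsub>M\<^esub> (k \<odot>\<^bsub>M\<^esub> y))"
      by (simp add: quotient_module_def ring.defs module.defs)
    also have "\<dots> = a_kernel M N h +>\<^bsub>M\<^esub> (k \<odot>\<^bsub>M\<^esub> x)"
      using x k by (auto simp: a_kernel_coset hom_smult)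
    finally show ?thesis
      using x k by (simp add: the_elem_coset hom_smult)
  qed
  ultimately show ?thesis
    by (simp add: module_iso_def)
qed

end

lemma carrier_quotient_module_self:
  assumes "abelian_group M"
  shows "carrier (quotient_module M (carrier M)) = {\<zero>\<^bsub>quotient_module M (carrier M)\<^esub>}"
proof -
  interpret abelian_group M by (fact assms)
  have "carrier M +>\<^bsub>M\<^esub> x = carrier M" if "x \<in> carrier M" for x
    using that a_coset_join2 add.subgroup_self by simp
  then show ?thesis
    using zero_closed
    by (auto simp: quotient_module_def ring.defs module.defs FactRing_def A_RCOSETS_def')
qed

lemma cohomology_iso_nonempty:
  assumes d: "module_morphism R (C i) (C (Suc i)) (d i)"
    and \<phi>: "module_morphism R (C i) N \<phi>"
    and surj: "\<phi> ` cocycles C d i = carrier N"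
    and ker: "{x \<in> cocycles C d i. \<phi> x = \<zero>\<^bsub>N\<^esub>} = coboundaries C d i"
  shows "module_iso R (cohomology C d i) N \<noteq> {}"
proof -
  let ?Z = "(C i)\<lparr>carrier := cocycles C d i\<rparr>"
  have "module_morphism R ?Z N \<phi>"
    unfolding cocycles_def
    by (intro module_morphism.restrict_submodule[OF \<phi>] module_morphism.a_kernel_submodule[OF d])
  moreover have "a_kernel ?Z N \<phi> = coboundaries C d i"
    by (simp add: a_kernel_def' ker)
  ultimately show ?thesis
    using module_morphism.first_isomorphism[of R ?Z N \<phi>] surj by (auto simp: cohomology_def)
qed

lemma carrier_cohomology_exact:
  assumes d: "module_morphism R (C i) (C (Suc i)) (d i)"
    and exact: "coboundaries C d i = cocycles C d i"
  shows "carrier (cohomology C d i) = {\<zero>\<^bsub>cohomology C d i\<^esub>}"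
proof -
  let ?Z = "(C i)\<lparr>carrier := cocycles C d i\<rparr>"
  have "submodule (cocycles C d i) R (C i)"
    unfolding cocycles_def using d by (rule module_morphism.a_kernel_submodule)
  then have "module R ?Z"
    using d by (simp add: submodule.submodule_is_module module_morphism_def)
  then have "carrier (quotient_module ?Z (carrier ?Z)) = {\<zero>\<^bsub>quotient_module ?Z (carrier ?Z)\<^esub>}"
    by (intro carrier_quotient_module_self module.axioms(2))
  then show ?thesis
    by (simp add: cohomology_def exact)
qed

lemma module_dirsum_simps:
  "carrier (module_dirsum M N) = carrier M \<times> carrier N"
  "add (module_dirsum M N) = (\<lambda>(x, y) (x', y'). (x \<oplus>\<^bsub>M\<^esub> x', y \<oplus>\<^bsub>N\<^esub> y'))"
  "ring.zero (module_dirsum M N) = (\<zero>\<^bsub>M\<^esub>, \<zero>\<^bsub>N\<^esub>)"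
  "module.smult (module_dirsum M N) = (\<lambda>k (x, y). (k \<odot>\<^bsub>M\<^esub> x, k \<odot>\<^bsub>N\<^esub> y))"
  by (simp_all add: module_dirsum_def ring.defs module.defs RDirProd_def DirProd_def monoid.defs)

lemma module_dirsum_module:
  assumes "module R M" and "module R N"
  shows "module R (module_dirsum M N)"
proof -
  interpret M: module R M by (fact assms(1))
  interpret N: module R N by (fact assms(2))
  have "abelian_group (module_dirsum M N)"
  proof (rule abelian_groupI, goal_cases)
    case (6 z)
    then show ?case
      by (intro bexI[of _ "(\<ominus>\<^bsub>M\<^esub> fst z, \<ominus>\<^bsub>N\<^esub> snd z)"])
        (auto simp: module_dirsum_simps M.M.l_neg N.M.l_neg)
  qed (auto simp: module_dirsum_simps M.M.a_ac N.M.a_ac)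
  with M.R.cring_axioms show ?thesis
    by (rule moduleI)
      (auto simp: module_dirsum_simps M.smult_l_distr N.smult_l_distr M.smult_r_distr
        N.smult_r_distr M.smult_assoc1 N.smult_assoc1)
qed

lemma (in module) zero_submodule: "submodule {\<zero>\<^bsub>M\<^esub>} R M"
  by (rule submoduleI) auto

lemma regular_module_simps:
  "carrier (regular_module R) = carrier R"
  "add (regular_module R) = add R"
  "ring.zero (regular_module R) = \<zero>\<^bsub>R\<^esub>"
  "module.smult (regular_module R) = monoid.mult R"
  by (simp_all add: regular_module_def ring.defs module.defs)

lemma regular_module_module:
  fixes R :: "'r ring"
  assumes "cring R"
  shows "module R (regular_module R)"
proof -
  interpret cring R by (fact assms)
  have "abelian_group (regular_module R)"
    by (rule abelian_groupI) (auto simp: regular_module_simps a_ac intro: l_neg)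
  with assms show ?thesis
    by (intro moduleI) (auto simp: regular_module_simps l_distr r_distr m_assoc)
qed

lemma ring_of_type_algebra_simps:
  "carrier ring_of_type_algebra = UNIV"
  "add ring_of_type_algebra = (+)"
  "ring.zero ring_of_type_algebra = 0"
  "monoid.mult ring_of_type_algebra = (*)"
  "one ring_of_type_algebra = 1"
  by (simp_all add: ring_of_type_algebra_def)

lemma linear_functional_morphism:
  fixes M :: "('k::field, 'a) module"
  assumes "module ring_of_type_algebra M"
    and "\<And>x y. x \<in> carrier M \<Longrightarrow> y \<in> carrier M \<Longrightarrow> \<phi> (x \<oplus>\<^bsub>M\<^esub> y) = \<phi> x + \<phi> y"
    and "\<And>k x. x \<in> carrier M \<Longrightarrow> \<phi> (k \<odot>\<^bsub>M\<^esub> x) = k * \<phi> x"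
  shows "module_morphism ring_of_type_algebra M (regular_module ring_of_type_algebra) \<phi>"
  by (rule module_morphismI[OF assms(1) regular_module_module[OF cring_from_type_algebra]])
    (simp_all add: regular_module_simps ring_of_type_algebra_simps assms(2,3))


section \<open>Nonarchimedean fields\<close>

lemma tendsto_max_0_iff:
  fixes f g :: "'a \<Rightarrow> real"
  assumes "\<And>x. 0 \<le> f x" and "\<And>x. 0 \<le> g x"
  shows "((\<lambda>x. max (f x) (g x)) \<longlongrightarrow> 0) F \<longleftrightarrow> (f \<longlongrightarrow> 0) F \<and> (g \<longlongrightarrow> 0) F"
proof (intro iffI conjI)
  assume lim: "((\<lambda>x. max (f x) (g x)) \<longlongrightarrow> 0) F"
  show "(f \<longlongrightarrow> 0) F" "(g \<longlongrightarrow> 0) F"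
    by (rule tendsto_sandwich[OF _ _ tendsto_const lim]; simp add: assms)+
next
  assume "(f \<longlongrightarrow> 0) F \<and> (g \<longlongrightarrow> 0) F"
  then show "((\<lambda>x. max (f x) (g x)) \<longlongrightarrow> 0) F"
    using tendsto_max[of f 0 F g 0] by simp
qed

lemma powr_sign_eq_max:
  fixes c :: real
  assumes "0 < c" and "c \<le> 1" and "b \<le> a"
  shows "c powr ((if 0 \<le> x then b else a) * x) = max (c powr (a * x)) (c powr (b * x))"
proof (cases "0 \<le> x")
  case True
  then have "c powr (a * x) \<le> c powr (b * x)"
    using assms by (intro powr_mono' mult_right_mono) auto
  with True show ?thesis
    by simp
next
  case False
  then have "c powr (b * x) \<le> c powr (a * x)"
    using assms by (intro powr_mono' mult_right_mono_neg) auto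
  with False show ?thesis
    by simp
qed

lemma powr_le_max_powr:
  fixes c :: real
  assumes "0 < c" and "c \<le> 1" and "b \<le> s" and "s \<le> a"
  shows "c powr (s * x) \<le> max (c powr (a * x)) (c powr (b * x))"
proof -
  have "(if 0 \<le> x then b else a) * x \<le> s * x"
    using assms by (simp add: mult_right_mono mult_right_mono_neg)
  then have "c powr (s * x) \<le> c powr ((if 0 \<le> x then b else a) * x)"
    using assms by (intro powr_mono') auto
  also have "\<dots> = max (c powr (a * x)) (c powr (b * x))"
    using assms by (intro powr_sign_eq_max) auto
  finally show ?thesis .
qed

locale nonarchimedean_field =
  fixes v :: "'k::field \<Rightarrow> real"
  assumes val_nonneg: "0 \<le> v x"
    and val_eq_0_iff: "v x = 0 \<longleftrightarrow> x = 0"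
    and val_mult: "v (x * y) = v x * v y"
    and val_add_le_max: "v (x + y) \<le> max (v x) (v y)"
begin

lemma val_0 [simp]: "v 0 = 0"
  by (simp add: val_eq_0_iff)

lemma val_1 [simp]: "v 1 = 1"
  using val_mult[of 1 1] val_eq_0_iff[of 1] by simp

lemma val_power: "v (x ^ n) = v x ^ n"
  by (induction n) (simp_all add: val_mult)

lemma val_inverse: "v (inverse x) = inverse (v x)"
proof (cases "x = 0")
  case False
  then have "v x * v (inverse x) = 1"
    by (simp flip: val_mult)
  then show ?thesis
    by (metis inverse_unique)
qed simp

lemma val_divide: "v (x / y) = v x / v y"
  by (simp add: divide_inverse val_mult val_inverse)

lemma val_powi: "v (x powi m) = v x powi m"
  by (simp add: power_int_def val_power val_inverse)

lemma val_minus [simp]: "v (- x) = v x"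
proof -
  have "v (-1) ^ 2 = 1"
    by (simp flip: val_power)
  then have "v (-1) = 1"
    using val_nonneg[of "-1"] by (simp add: power2_eq_1_iff)
  then show ?thesis
    using val_mult[of "-1" x] by simp
qed

lemma val_diff_le_max: "v (x - y) \<le> max (v x) (v y)"
  using val_add_le_max[of x "- y"] by simp

lemma val_diff_eq_max:
  assumes "v x \<noteq> v y"
  shows "v (x - y) = max (v x) (v y)"
proof -
  have "v x \<le> max (v (x - y)) (v y)"
    using val_add_le_max[of "x - y" y] by simp
  moreover have "v y \<le> max (v x) (v (x - y))"
    using val_diff_le_max[of x "x - y"] by simp
  ultimately show ?thesis
    using assms val_diff_le_max[of x y] by (auto simp: max_def split: if_splits)
qed

end

lemma (in perfectoid_field) nonarchimedean_field: "nonarchimedean_field v"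
  by unfold_locales (auto simp: nonneg eq_0_iff mult ultrametric)


section \<open>Fractional powers of the parameter\<close>

definition p_fractions :: "nat \<Rightarrow> rat set"
  where "p_fractions p = (\<Union>j. p_inv_ints p j)"

lemma p_inv_ints_mono:
  assumes "0 < p" and "i \<le> j"
  shows "p_inv_ints p i \<subseteq> p_inv_ints p j"
proof
  fix x assume "x \<in> p_inv_ints p i"
  then obtain m where "x = of_int m / of_nat p ^ i"
    by (auto simp: p_inv_ints_def)
  moreover obtain d where "j = i + d"
    using assms(2) le_iff_add by blast
  ultimately have "x = of_int (m * int p ^ d) / of_nat p ^ j"
    using assms(1) by (simp add: power_add)
  then show "x \<in> p_inv_ints p j"
    unfolding p_inv_ints_def by blast
qed

lemma zero_in_p_inv_ints: "0 \<in> p_inv_ints p j"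
  by (auto simp: p_inv_ints_def intro: exI[of _ 0])

lemma of_int_mult_p_fractions:
  assumes "x \<in> p_fractions p"
  shows "of_int k * x \<in> p_fractions p"
proof -
  obtain j m where "x = of_int m / of_nat p ^ j"
    using assms by (auto simp: p_fractions_def p_inv_ints_def)
  then have "of_int k * x = of_int (k * m) / of_nat p ^ j"
    by simp
  then show ?thesis
    unfolding p_fractions_def p_inv_ints_def by blast
qed

lemma root_pow_0 [simp]: "root_pow p r 0 = 1"
  by (simp add: root_pow_def)

locale tate_parameter = nonarchimedean_field v for v :: "'k::field \<Rightarrow> real" +
  fixes p :: nat and q :: 'k and r :: "nat \<Rightarrow> 'k"
  assumes val_q_pos: "0 < v q" and val_q_less_1: "v q < 1"
    and r_0: "r 0 = q" and r_Suc: "r (Suc j) ^ p = r j"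
begin

lemma p_pos: "0 < p"
proof (rule ccontr)
  assume "\<not> 0 < p"
  then have "q = 1"
    using r_Suc[of 0] by (simp add: r_0)
  with val_q_less_1 show False
    by simp
qed

lemma val_root: "v (r j) = v q powr (1 / real p ^ j)"
proof -
  have "r j ^ (p ^ j) = q"
    by (induction j) (simp_all add: r_0 r_Suc power_mult)
  then have pow: "v (r j) ^ (p ^ j) = v q"
    by (simp flip: val_power)
  then have "0 < v (r j)"
    using val_q_pos val_nonneg[of "r j"] p_pos by (cases "v (r j) = 0") (auto simp: power_0_left)
  then show ?thesis
    using p_pos by (simp add: powr_powr flip: pow powr_realpow)
qed

lemma val_root_pow:
  assumes "x \<in> p_fractions p"
  shows "v (root_pow p r x) = v q powr real_of_rat x"
proof -
  define j where "j = (LEAST j. x \<in> p_inv_ints p j)"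
  have "x \<in> p_inv_ints p j"
    unfolding j_def using assms by (auto simp: p_fractions_def intro: LeastI)
  then obtain m where m: "x = of_int m / of_nat p ^ j"
    by (auto simp: p_inv_ints_def)
  have "v (root_pow p r x) = v (r j) powi m"
    using p_pos unfolding root_pow_def j_def[symmetric] Let_def by (simp add: m val_powi)
  also have "\<dots> = v q powr real_of_rat x"
    using val_q_pos
    by (simp add: val_root m of_rat_divide of_rat_power powr_powr flip: powr_real_of_int')
  finally show ?thesis .
qed

lemma val_1_minus_root_pow:
  assumes "x \<in> p_fractions p" and "x \<noteq> 0"
  shows "v (1 - root_pow p r x) = max 1 (v q powr real_of_rat x)"
proof -
  have "v q powr real_of_rat x \<noteq> 1"
    using assms(2) val_q_pos val_q_less_1 by (simp add: powr_eq_one_iff_gen)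
  then show ?thesis
    using assms(1) by (subst val_diff_eq_max) (simp_all add: val_root_pow)
qed

lemma val_root_pow_minus_3:
  assumes "n \<in> p_fractions p"
  shows "v (root_pow p r (- 3 * n)) = v q powr (- 3 * real_of_rat n)"
  using val_root_pow[OF of_int_mult_p_fractions[OF assms, of "-3"]]
  by (simp add: of_rat_mult of_rat_minus)

lemma val_1_minus_root_pow_minus_3:
  assumes "n \<in> p_fractions p" and "n \<noteq> 0"
  shows "v (1 - root_pow p r (- 3 * n)) = max 1 (v q powr (- 3 * real_of_rat n))"
  using val_1_minus_root_pow[OF of_int_mult_p_fractions[OF assms(1), of "-3"]] assms(2)
  by (simp add: of_rat_mult of_rat_minus)

lemma root_pow_minus_3_neq_1:
  assumes "n \<in> p_fractions p" and "n \<noteq> 0"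
  shows "root_pow p r (- 3 * n) \<noteq> 1"
  using val_1_minus_root_pow_minus_3[OF assms] by (auto simp: max_def split: if_splits)


section \<open>Series on circles\<close>

text \<open>The terms of the series \<open>c\<close> tend to \<open>0\<close> on the circle \<open>|X| = |q|\<^sup>s\<close>.\<close>

definition converges_on_circle :: "real \<Rightarrow> (rat \<Rightarrow> 'k) \<Rightarrow> bool"
  where "converges_on_circle s c \<longleftrightarrow>
    ((\<lambda>n. v (c n) * v q powr (s * real_of_rat n)) \<longlongrightarrow> 0) cofinite"

lemma converges_on_circle_comparison:
  assumes "converges_on_circle t d"
    and "\<And>n. v (c n) * v q powr (s * real_of_rat n) \<le> v (d n) * v q powr (t * real_of_rat n)"
  shows "converges_on_circle s c"
  unfolding converges_on_circle_def
  by (rule tendsto_sandwich[OF _ _ tendsto_const assms(1)[unfolded converges_on_circle_def]])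
    (use assms(2) in \<open>auto simp: val_nonneg\<close>)

lemma converges_on_circle_add:
  assumes c: "converges_on_circle s c" and d: "converges_on_circle s d"
  shows "converges_on_circle s (\<lambda>n. c n + d n)"
  unfolding converges_on_circle_def
proof (rule tendsto_sandwich[OF _ _ tendsto_const])
  let ?w = "\<lambda>n. v q powr (s * real_of_rat n)"
  show "((\<lambda>n. max (v (c n) * ?w n) (v (d n) * ?w n)) \<longlongrightarrow> 0) cofinite"
    using c d by (simp add: converges_on_circle_def tendsto_max_0_iff val_nonneg)
  show "\<forall>\<^sub>F n in cofinite. v (c n + d n) * ?w n \<le> max (v (c n) * ?w n) (v (d n) * ?w n)"
    using mult_right_mono[OF val_add_le_max] by (simp add: max_mult_distrib_right)
qed (simp add: val_nonneg)

lemma converges_on_circle_smult: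
  assumes "converges_on_circle s c"
  shows "converges_on_circle s (\<lambda>n. k * c n)"
  using tendsto_mult_left[OF assms[unfolded converges_on_circle_def], of "v k"]
  by (simp add: converges_on_circle_def val_mult mult.assoc)

lemma converges_on_circle_finite:
  assumes "finite {n. c n \<noteq> 0}"
  shows "converges_on_circle s c"
  unfolding converges_on_circle_def
  by (rule tendsto_eventually) (use assms in \<open>auto simp: eventually_cofinite elim: rev_finite_subset\<close>)

lemma annulus_series_iff:
  assumes E: "E \<subseteq> p_fractions p" and ab: "b \<le> a"
  shows "c \<in> annulus_series v p r E a b \<longleftrightarrow>
    {n. c n \<noteq> 0} \<subseteq> E \<and> converges_on_circle a c \<and> converges_on_circle b c"
proof (cases "{n. c n \<noteq> 0} \<subseteq> E")
  case True
  define N where "N s n = v (c n) * v q powr (s * real_of_rat n)" for s n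
  have "v (c n * root_pow p r (of_int (if 0 \<le> n then b else a) * n)) = max (N a n) (N b n)" for n
  proof (cases "c n = 0")
    case False
    with True E have n: "n \<in> p_fractions p"
      by auto
    have "v (c n * root_pow p r (of_int (if 0 \<le> n then b else a) * n)) =
        v (c n) * v q powr ((if 0 \<le> real_of_rat n then real_of_int b else a) * real_of_rat n)"
      using n by (simp add: val_mult val_root_pow of_int_mult_p_fractions of_rat_mult)
    also have "\<dots> = max (N a n) (N b n)"
      using ab val_q_pos val_q_less_1 val_nonneg
      by (subst powr_sign_eq_max) (simp_all add: N_def max_mult_distrib_left)
    finally show ?thesis .
  qed (simp add: N_def)
  with True show ?thesis
    by (auto simp: annulus_series_def converges_on_circle_def tendsto_max_0_iff val_nonneg N_def)
qed (auto simp: annulus_series_def)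

end

text \<open>
  The family \<open>\<S>\<close> consists of the admissible supports of series: the sets of fractions of bounded
  denominator for the union, all subsets of \<open>\<int>[1/p]\<close> for the completion.
\<close>

locale support_ideal = tate_parameter v p q r
  for v :: "'k::field \<Rightarrow> real" and p and q :: 'k and r +
  fixes \<S> :: "rat set set"
  assumes support_p_fractions: "S \<in> \<S> \<Longrightarrow> S \<subseteq> p_fractions p"
    and support_subset: "S \<in> \<S> \<Longrightarrow> T \<subseteq> S \<Longrightarrow> T \<in> \<S>"
    and support_Un: "S \<in> \<S> \<Longrightarrow> T \<in> \<S> \<Longrightarrow> S \<union> T \<in> \<S>"
    and support_0: "{0} \<in> \<S>"
begin

definition circle_series :: "real \<Rightarrow> (rat \<Rightarrow> 'k) set"
  where "circle_series s = {c. {n. c n \<noteq> 0} \<in> \<S> \<and> converges_on_circle s c}"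

lemma circle_series_exponent: "c \<in> circle_series s \<Longrightarrow> c n \<noteq> 0 \<Longrightarrow> n \<in> p_fractions p"
  using support_p_fractions by (auto simp: circle_series_def)

lemma circle_series_comparison:
  assumes d: "d \<in> circle_series t"
    and zero: "\<And>n. d n = 0 \<Longrightarrow> c n = 0"
    and le: "\<And>n. n \<in> p_fractions p \<Longrightarrow>
      v (c n) * v q powr (s * real_of_rat n) \<le> v (d n) * v q powr (t * real_of_rat n)"
  shows "c \<in> circle_series s"
proof -
  have "v (c n) * v q powr (s * real_of_rat n) \<le> v (d n) * v q powr (t * real_of_rat n)" for n
    using le circle_series_exponent[OF d, of n] zero[of n] by (cases "d n = 0") auto
  moreover have "{n. c n \<noteq> 0} \<in> \<S>"
    using d zero by (auto simp: circle_series_def elim!: support_subset)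
  ultimately show ?thesis
    using d converges_on_circle_comparison by (auto simp: circle_series_def)
qed

lemma circle_series_add:
  assumes c: "c \<in> circle_series s" and d: "d \<in> circle_series s"
  shows "(\<lambda>n. c n + d n) \<in> circle_series s"
proof -
  have "{n. c n \<noteq> 0} \<union> {n. d n \<noteq> 0} \<in> \<S>"
    using c d by (simp add: circle_series_def support_Un)
  then have "{n. c n + d n \<noteq> 0} \<in> \<S>"
    by (rule support_subset) auto
  then show ?thesis
    using c d by (simp add: circle_series_def converges_on_circle_add)
qed

lemma circle_series_smult:
  assumes "c \<in> circle_series s"
  shows "(\<lambda>n. k * c n) \<in> circle_series s"
  using assms by (auto simp: circle_series_def converges_on_circle_smult elim: support_subset)

lemma circle_series_diff:
  assumes "c \<in> circle_series s" and "d \<in> circle_series s"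
  shows "(\<lambda>n. c n - d n) \<in> circle_series s"
  using circle_series_add[OF assms(1) circle_series_smult[OF assms(2), of "-1"]] by simp

lemma constant_in_circle_series:
  assumes "\<And>n. n \<noteq> 0 \<Longrightarrow> c n = 0"
  shows "c \<in> circle_series s"
proof -
  have sub: "{n. c n \<noteq> 0} \<subseteq> {0}"
    using assms by auto
  then have "{n. c n \<noteq> 0} \<in> \<S>"
    by (rule support_subset[OF support_0])
  moreover have "converges_on_circle s c"
    using sub by (intro converges_on_circle_finite) (auto elim: finite_subset)
  ultimately show ?thesis
    by (simp add: circle_series_def)
qed

lemma tate_glue_circle_series:
  assumes "c \<in> circle_series s"
  shows "tate_glue p r c \<in> circle_series (s + 3)"
proof (rule circle_series_comparison[OF assms])
  fix n assume "n \<in> p_fractions p"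
  then have "v (tate_glue p r c n) * v q powr ((s + 3) * real_of_rat n) =
      v (c n) * (v q powr (- 3 * real_of_rat n) * v q powr ((s + 3) * real_of_rat n))"
    using val_root_pow_minus_3[of n] by (simp add: tate_glue_def val_mult)
  then show "v (tate_glue p r c n) * v q powr ((s + 3) * real_of_rat n) \<le>
      v (c n) * v q powr (s * real_of_rat n)"
    by (simp add: algebra_simps flip: powr_add)
qed (simp add: tate_glue_def)

text \<open>At \<open>n = 0\<close> the denominator vanishes, and the coefficient is \<open>x / 0 = 0\<close>.\<close>

lemma divide_1_minus_root_pow_circle_series:
  assumes c: "c \<in> circle_series s" and t: "t \<le> s" "s \<le> t + 3"
  shows "(\<lambda>n. c n / (1 - root_pow p r (- 3 * n))) \<in> circle_series t"
proof (rule circle_series_comparison[OF c])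
  fix n assume n: "n \<in> p_fractions p"
  define x where "x = real_of_rat n"
  show "v (c n / (1 - root_pow p r (- 3 * n))) * v q powr (t * real_of_rat n) \<le>
    v (c n) * v q powr (s * real_of_rat n)"
  proof (cases "n = 0")
    case False
    have "v q powr (t * x) \<le> max (v q powr (s * x)) (v q powr ((s - 3) * x))"
      using t val_q_pos val_q_less_1 by (intro powr_le_max_powr) auto
    also have "\<dots> = v q powr (s * x) * max 1 (v q powr (- 3 * x))"
      by (simp add: max_mult_distrib_left algebra_simps flip: powr_add)
    finally have "v (c n) * v q powr (t * x) \<le>
        v (c n) * (v q powr (s * x) * max 1 (v q powr (- 3 * x)))"
      by (rule mult_left_mono[OF _ val_nonneg])
    then show ?thesis
      using val_1_minus_root_pow_minus_3[OF n False]
      by (simp add: val_divide x_def[symmetric] divide_simps mult.assoc)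
  qed (simp add: val_nonneg)
qed simp

lemma divide_1_minus_root_pow_mult_cancel:
  assumes "c \<in> circle_series s" and "n \<noteq> 0"
  shows "c n / (1 - root_pow p r (- 3 * n)) * (1 - root_pow p r (- 3 * n)) = c n"
proof (cases "c n = 0")
  case False
  with assms(1) have "n \<in> p_fractions p"
    by (rule circle_series_exponent)
  then have "root_pow p r (- 3 * n) \<noteq> 1"
    using assms(2) by (rule root_pow_minus_3_neq_1)
  then show ?thesis
    by simp
qed simp

lemma tate_system_solvable:
  assumes h: "h \<in> circle_series 1" and k: "k \<in> circle_series 2" and hk: "h 0 = k 0"
  obtains f g where "f \<in> circle_series 1 \<inter> circle_series (- 1)"
    and "g \<in> circle_series 2 \<inter> circle_series 1"
    and "h = (\<lambda>n. f n - g n)" and "k = (\<lambda>n. tate_glue p r f n - g n)"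
proof
  define u where "u n = root_pow p r (- 3 * n)" for n
  define f where "f n = h n / (1 - u n) - k n / (1 - u n)" for n
  define g where "g n = f n - h n" for n
  have f_circle: "f \<in> circle_series t" if "t \<le> 1" "- 1 \<le> t" for t
    unfolding f_def[abs_def] u_def using that
    by (intro circle_series_diff divide_1_minus_root_pow_circle_series[OF h]
        divide_1_minus_root_pow_circle_series[OF k]) auto
  have f_mult: "f n * (1 - u n) = h n - k n" for n
  proof (cases "n = 0")
    case False
    then show ?thesis
      using divide_1_minus_root_pow_mult_cancel[OF h] divide_1_minus_root_pow_mult_cancel[OF k]
      unfolding f_def u_def left_diff_distrib by simp
  qed (simp add: f_def u_def hk)
  have g_eq: "g n = tate_glue p r f n - k n" for n
    using f_mult[of n] by (simp add: g_def tate_glue_def u_def algebra_simps)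
  show "f \<in> circle_series 1 \<inter> circle_series (- 1)"
    by (simp add: f_circle)
  have "g \<in> circle_series 2"
    unfolding g_eq[abs_def] using k tate_glue_circle_series[OF f_circle[of "-1"]]
    by (intro circle_series_diff) auto
  moreover have "g \<in> circle_series 1"
    unfolding g_def[abs_def] using h by (intro circle_series_diff f_circle) auto
  ultimately show "g \<in> circle_series 2 \<inter> circle_series 1"
    by simp
  show "h = (\<lambda>n. f n - g n)"
    by (simp add: g_def)
  show "k = (\<lambda>n. tate_glue p r f n - g n)"
    by (simp add: g_eq)
qed

lemma tate_glue_fixed_iff:
  assumes "c \<in> circle_series s"
  shows "tate_glue p r c = c \<longleftrightarrow> (\<forall>n. n \<noteq> 0 \<longrightarrow> c n = 0)"
proof
  assume fixed: "tate_glue p r c = c"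
  have "c n * root_pow p r (- 3 * n) = c n" for n
    using fun_cong[OF fixed, of n] by (simp add: tate_glue_def)
  then show "\<forall>n. n \<noteq> 0 \<longrightarrow> c n = 0"
    using circle_series_exponent[OF assms] root_pow_minus_3_neq_1 by auto
next
  assume "\<forall>n. n \<noteq> 0 \<longrightarrow> c n = 0"
  then have "tate_glue p r c n = c n" for n
    by (cases "n = 0") (simp_all add: tate_glue_def)
  then show "tate_glue p r c = c" ..
qed

end


section \<open>The Cech complex\<close>

lemma series_algebra_simps:
  "carrier (series_algebra v S) = S"
  "add (series_algebra v S) = (\<lambda>c c' n. c n + c' n)"
  "ring.zero (series_algebra v S) = (\<lambda>n. 0)"
  "module.smult (series_algebra v S) = (\<lambda>k c n. k * c n)"
  by (simp_all add: series_algebra_def)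

lemma series_algebra_module:
  fixes v :: "'k::field \<Rightarrow> real"
  assumes zero: "(\<lambda>n. 0) \<in> S"
    and add: "\<And>c d. c \<in> S \<Longrightarrow> d \<in> S \<Longrightarrow> (\<lambda>n. c n + d n) \<in> S"
    and smult: "\<And>k c. c \<in> S \<Longrightarrow> (\<lambda>n. k * c n) \<in> S"
  shows "module (ring_of_type_algebra :: 'k ring) (series_algebra v S)"
proof -
  have "abelian_group (series_algebra v S)"
  proof (rule abelian_groupI, goal_cases)
    case (6 c)
    then show ?case
      using smult[of c "-1"]
      by (intro bexI[of _ "\<lambda>n. -1 * c n"]) (simp_all add: series_algebra_simps)
  qed (simp_all add: series_algebra_simps zero add algebra_simps)
  then show ?thesis
    by (intro moduleI cring_from_type_algebra)
      (auto simp: series_algebra_simps ring_of_type_algebra_simps smult algebra_simps)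
qed

locale tate_cover = support_ideal v p q r \<S>
  for v :: "'k::field \<Rightarrow> real" and p and q :: 'k and r and \<S> +
  fixes A :: "int \<Rightarrow> int \<Rightarrow> ('k, rat \<Rightarrow> 'k) module"
  assumes annulus_eq_circles: "b \<le> a \<Longrightarrow> A a b = series_algebra v (circle_series a \<inter> circle_series b)"
begin

abbreviation K :: "'k ring"
  where "K \<equiv> ring_of_type_algebra"

abbreviation C :: "nat \<Rightarrow> ('k, (rat \<Rightarrow> 'k) \<times> (rat \<Rightarrow> 'k)) module"
  where "C \<equiv> tate_cochains A"

abbreviation d :: "nat \<Rightarrow> (rat \<Rightarrow> 'k) \<times> (rat \<Rightarrow> 'k) \<Rightarrow> (rat \<Rightarrow> 'k) \<times> (rat \<Rightarrow> 'k)"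
  where "d \<equiv> tate_diff p r"

lemma annulus_module:
  assumes "b \<le> a"
  shows "module K (A a b)"
  unfolding annulus_eq_circles[OF assms]
  by (rule series_algebra_module)
    (auto intro: constant_in_circle_series circle_series_add circle_series_smult)

lemma tate_cochains_module: "module K (C i)"
proof -
  have "module K (module_dirsum (A 1 1) (A 2 2))"
    by (simp add: module_dirsum_module annulus_module)
  then show ?thesis
    by (auto simp: tate_cochains_def module_dirsum_module annulus_module
        intro!: submodule.submodule_is_module[OF module.zero_submodule])
qed

lemma carrier_tate_cochains:
  "carrier (C 0) = (circle_series 1 \<inter> circle_series (- 1)) \<times> (circle_series 2 \<inter> circle_series 1)"
  "carrier (C (Suc 0)) = circle_series 1 \<times> circle_series 2"
  "carrier (C (Suc (Suc i))) = {(\<lambda>n. 0, \<lambda>n. 0)}"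
  by (simp_all add: tate_cochains_def annulus_eq_circles module_dirsum_simps series_algebra_simps)

lemma tate_cochains_simps:
  "add (C i) = (\<lambda>(f, g) (f', g'). (\<lambda>n. f n + f' n, \<lambda>n. g n + g' n))"
  "ring.zero (C i) = (\<lambda>n. 0, \<lambda>n. 0)"
  "module.smult (C i) = (\<lambda>k (f, g). (\<lambda>n. k * f n, \<lambda>n. k * g n))"
  by (simp_all add: tate_cochains_def annulus_eq_circles module_dirsum_simps series_algebra_simps)

lemma tate_diff_closed:
  assumes "x \<in> carrier (C i)"
  shows "d i x \<in> carrier (C (Suc i))"
proof (cases i)
  case 0
  obtain f g where x: "x = (f, g)" "f \<in> circle_series 1" "f \<in> circle_series (- 1)"
    "g \<in> circle_series 2" "g \<in> circle_series 1"
    using assms by (auto simp: 0 carrier_tate_cochains)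
  then have "tate_glue p r f \<in> circle_series 2"
    using tate_glue_circle_series[of f "-1"] by simp
  with x show ?thesis
    by (simp add: 0 tate_diff_def carrier_tate_cochains circle_series_diff)
qed (auto simp: tate_diff_def carrier_tate_cochains split_beta)

lemma tate_diff_morphism: "module_morphism K (C i) (C (Suc i)) (d i)"
  by (rule module_morphismI[OF tate_cochains_module tate_cochains_module tate_diff_closed])
    (auto simp: tate_cochains_simps tate_diff_def tate_glue_def algebra_simps)

lemma cocycles_0: "cocycles C d 0 = {(c, c) | c. \<forall>n. n \<noteq> 0 \<longrightarrow> c n = 0}"
proof -
  have "(f, g) \<in> cocycles C d 0 \<longleftrightarrow> g = f \<and> (\<forall>n. n \<noteq> 0 \<longrightarrow> f n = 0)" for f g
  proof -
    have "d 0 (f, g) = (\<lambda>n. 0, \<lambda>n. 0) \<longleftrightarrow> g = f \<and> tate_glue p r f = f"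
      by (auto simp: tate_diff_def fun_eq_iff)
    then show ?thesis
      using tate_glue_fixed_iff[of f 1] constant_in_circle_series[of f]
      by (auto simp: cocycles_def a_kernel_def' carrier_tate_cochains tate_cochains_simps)
  qed
  then show ?thesis
    by auto
qed

lemma cocycles_Suc: "cocycles C d (Suc i) = carrier (C (Suc i))"
  by (auto simp: cocycles_def a_kernel_def' tate_cochains_simps tate_diff_def)

lemma coboundaries_1:
  "coboundaries C d (Suc 0) = {(h, k) \<in> circle_series 1 \<times> circle_series 2. h 0 = k 0}"
proof (intro equalityI subsetI)
  fix x assume "x \<in> coboundaries C d (Suc 0)"
  then obtain y where y: "y \<in> carrier (C 0)" "x = d 0 y"
    by (auto simp: coboundaries_def)
  have "fst x 0 = snd x 0"
    by (simp add: y tate_diff_def tate_glue_def split_beta)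
  then show "x \<in> {(h, k) \<in> circle_series 1 \<times> circle_series 2. h 0 = k 0}"
    using tate_diff_closed[OF y(1)] by (auto simp: y(2) carrier_tate_cochains)
next
  fix x assume "x \<in> {(h, k) \<in> circle_series 1 \<times> circle_series 2. h 0 = k 0}"
  then obtain h k where x: "x = (h, k)" "h \<in> circle_series 1" "k \<in> circle_series 2" "h 0 = k 0"
    by auto
  obtain f g where fg: "f \<in> circle_series 1 \<inter> circle_series (- 1)"
      "g \<in> circle_series 2 \<inter> circle_series 1"
    and "h = (\<lambda>n. f n - g n)" "k = (\<lambda>n. tate_glue p r f n - g n)"
    using x(2-4) by (rule tate_system_solvable)
  then have "x = d 0 (f, g)"
    by (simp add: x(1) tate_diff_def)
  moreover have "(f, g) \<in> carrier (C 0)"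
    using fg by (simp add: carrier_tate_cochains)
  ultimately show "x \<in> coboundaries C d (Suc 0)"
    by (simp add: coboundaries_def)
qed

lemma coboundaries_ge_2: "coboundaries C d (Suc (Suc i)) = {(\<lambda>n. 0, \<lambda>n. 0)}"
proof -
  interpret module K "C (Suc i)"
    by (rule tate_cochains_module)
  have "(\<lambda>n. 0, \<lambda>n. 0) \<in> carrier (C (Suc i))"
    using M.zero_closed by (simp only: tate_cochains_simps)
  then show ?thesis
    by (force simp: coboundaries_def tate_diff_def)
qed

theorem tate_cohomology_0: "module_iso K (tate_cohomology p r A 0) (regular_module K) \<noteq> {}"
  unfolding tate_cohomology_def
proof (rule cohomology_iso_nonempty[where \<phi> = "\<lambda>(f, g). f 0"])
  have "k \<in> (\<lambda>(f, g). f 0) ` cocycles C d 0" for k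
    by (rule image_eqI[of _ _ "(\<lambda>n. if n = 0 then k else 0, \<lambda>n. if n = 0 then k else 0)"])
      (auto simp: cocycles_0)
  then show "(\<lambda>(f, g). f 0) ` cocycles C d 0 = carrier (regular_module K)"
    by (auto simp: regular_module_simps ring_of_type_algebra_simps)
  have "c = (\<lambda>n. 0)" if "\<forall>n. n \<noteq> 0 \<longrightarrow> c n = 0" "c 0 = 0" for c :: "rat \<Rightarrow> 'k"
    using that by (metis ext)
  then show "{x \<in> cocycles C d 0. (case x of (f, g) \<Rightarrow> f 0) = \<zero>\<^bsub>regular_module K\<^esub>} =
      coboundaries C d 0"
    by (auto simp: cocycles_0 coboundaries_def tate_cochains_simps regular_module_simps
        ring_of_type_algebra_simps)
  show "module_morphism K (C 0) (regular_module K) (\<lambda>(f, g). f 0)"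
    by (rule linear_functional_morphism[OF tate_cochains_module]) (auto simp: tate_cochains_simps)
qed (rule tate_diff_morphism)

theorem tate_cohomology_1: "module_iso K (tate_cohomology p r A 1) (regular_module K) \<noteq> {}"
  unfolding tate_cohomology_def One_nat_def
proof (rule cohomology_iso_nonempty[where \<phi> = "\<lambda>(h, k). h 0 - k 0"])
  have "c \<in> (\<lambda>(h, k). h 0 - k 0) ` cocycles C d (Suc 0)" for c
    by (rule image_eqI[of _ _ "(\<lambda>n. if n = 0 then c else 0, \<lambda>n. 0)"])
      (auto simp: cocycles_Suc carrier_tate_cochains constant_in_circle_series)
  then show "(\<lambda>(h, k). h 0 - k 0) ` cocycles C d (Suc 0) = carrier (regular_module K)"
    by (auto simp: regular_module_simps ring_of_type_algebra_simps)
  show "{x \<in> cocycles C d (Suc 0). (case x of (h, k) \<Rightarrow> h 0 - k 0) = \<zero>\<^bsub>regular_module K\<^esub>} =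
      coboundaries C d (Suc 0)"
    by (auto simp: cocycles_Suc coboundaries_1 carrier_tate_cochains regular_module_simps
        ring_of_type_algebra_simps)
  show "module_morphism K (C (Suc 0)) (regular_module K) (\<lambda>(h, k). h 0 - k 0)"
    by (rule linear_functional_morphism[OF tate_cochains_module])
      (auto simp: tate_cochains_simps algebra_simps)
qed (rule tate_diff_morphism)

theorem tate_cohomology_ge_2:
  assumes "2 \<le> i"
  shows "carrier (tate_cohomology p r A i) = {\<zero>\<^bsub>tate_cohomology p r A i\<^esub>}"
proof -
  obtain m where m: "i = Suc (Suc m)"
    using assms by (auto simp: numeral_2_eq_2 Suc_le_eq dest: less_imp_Suc_add)
  show ?thesis
    unfolding tate_cohomology_def
  proof (rule carrier_cohomology_exact)
    show "coboundaries C d i = cocycles C d i"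
      by (simp add: m coboundaries_ge_2 cocycles_Suc carrier_tate_cochains)
  qed (rule tate_diff_morphism)
qed

end

context tate_parameter
begin

lemma tate_cover_annulus_union:
  "tate_cover v p q r {S. \<exists>j. S \<subseteq> p_inv_ints p j} (annulus_union v p r)"
proof -
  interpret support_ideal v p q r "{S. \<exists>j. S \<subseteq> p_inv_ints p j}"
  proof
    fix S T assume "S \<in> {S. \<exists>j. S \<subseteq> p_inv_ints p j}" "T \<in> {S. \<exists>j. S \<subseteq> p_inv_ints p j}"
    then obtain i j where "S \<subseteq> p_inv_ints p i" "T \<subseteq> p_inv_ints p j"
      by auto
    then have "S \<union> T \<subseteq> p_inv_ints p (max i j)"
      using p_inv_ints_mono[OF p_pos, of i "max i j"] p_inv_ints_mono[OF p_pos, of j "max i j"]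
      by auto
    then show "S \<union> T \<in> {S. \<exists>j. S \<subseteq> p_inv_ints p j}"
      by blast
  qed (auto simp: p_fractions_def zero_in_p_inv_ints)
  show ?thesis
  proof
    fix a b :: int assume ab: "b \<le> a"
    have "p_inv_ints p j \<subseteq> p_fractions p" for j
      by (auto simp: p_fractions_def)
    then have "(\<Union>j. annulus_series v p r (p_inv_ints p j) a b) = circle_series a \<inter> circle_series b"
      by (auto simp: annulus_series_iff[OF _ ab] circle_series_def) blast+
    then show "annulus_union v p r a b = series_algebra v (circle_series a \<inter> circle_series b)"
      by (simp add: annulus_union_def)
  qed
qed

lemma tate_cover_annulus_completed:
  "tate_cover v p q r (Pow (p_fractions p)) (annulus_completed v p r)"
proof -
  interpret support_ideal v p q r "Pow (p_fractions p)"
    by unfold_locales (auto simp: p_fractions_def zero_in_p_inv_ints)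
  show ?thesis
  proof
    fix a b :: int assume "b \<le> a"
    then have "annulus_series v p r (p_fractions p) a b = circle_series a \<inter> circle_series b"
      by (auto simp: annulus_series_iff circle_series_def)
    then show "annulus_completed v p r a b = series_algebra v (circle_series a \<inter> circle_series b)"
      by (simp add: annulus_completed_def flip: p_fractions_def)
  qed
qed

end

theorem theorem3:
  fixes v :: "'k::field \<Rightarrow> real" and p :: nat and q :: 'k and r :: "nat \<Rightarrow> 'k"
    and A :: "int \<Rightarrow> int \<Rightarrow> ('k, rat \<Rightarrow> 'k) module"
  assumes "perfectoid_field v p"
    and "0 < v q" and "v q < 1"
    and "r 0 = q" and "\<forall>j. r (Suc j) ^ p = r j"
    and "A = annulus_union v p r \<or> A = annulus_completed v p r"
  shows "\<forall>i. if i = 0 \<or> i = 1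
      then module_iso ring_of_type_algebra (tate_cohomology p r A i)
             (regular_module (ring_of_type_algebra :: 'k ring)) \<noteq> {}
      else carrier (tate_cohomology p r A i) = {\<zero>\<^bsub>tate_cohomology p r A i\<^esub>}"
proof -
  interpret tate_parameter v p q r
    using assms(2-5) perfectoid_field.nonarchimedean_field[OF assms(1)]
    by (simp add: tate_parameter_def tate_parameter_axioms_def)
  obtain \<S> where "tate_cover v p q r \<S> A"
    using assms(6) tate_cover_annulus_union tate_cover_annulus_completed by blast
  then interpret tate_cover v p q r \<S> A .
  have "carrier (tate_cohomology p r A i) = {\<zero>\<^bsub>tate_cohomology p r A i\<^esub>}"
    if "i \<noteq> 0" "i \<noteq> 1" for i
    using that by (intro tate_cohomology_ge_2) simp
  then show ?thesis
    using tate_cohomology_0 tate_cohomology_1 by simp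
qed

end
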